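(* Let $(K,v)$ be a valued field, $\overline{K}$ an algebraic closure of $K$, $\overline{v}$ an extension of $v$ to $\overline{K}$, and $X$ transcendental over $K$. Let $w$ be a valuation transcendental extension of $v$ to $K(X)$ and let $(a,\gamma)$ be a minimal pair of definition for $(K(X)|K,w)$. Assume that the extension $(K(a)|K,\overline{v})$ is unibranched. Then $$\overline{v}_{a',\gamma}|_{K(X)}=w\quad\text{for all conjugates }a'\text{ of }a\text{ over }K.$$ In particular, if $(K,v)$ is henselian, this conclusion holds for every $a\in\overline{K}$ such that $(a,\gamma)$ is a minimal pair of definition for $(K(X)|K,w)$.
   Context: Valuations are written additively; $vK$ and $Kv$ denote value group and residue field. An extension $w$ of $v$ to $K(X)$ is valuation transcendental if $\dim_{\mathbb{Q}}\left(\mathbb{Q}\otimes_{\mathbb{Z}} (wK(X)/vK)\right)+\mathrm{trdeg}[K(X)w:Kv]=1$. For $a\in\overline{K}$ and $\gamma$ in an ordered abelian group containing $\overline{v}\overline{K}$, $\overline{v}_{a,\gamma}$ is the valuation on $\overline{K}(X)$ with $\overline{v}_{a,\gamma}\left(\sum_i c_i(X-a)^i\right)=\min_i\{\overline{v}c_i+i\gamma\}$ for $c_i\in\overline{K}$. $(a,\gamma)$ is a pair of definition for $(K(X)|K,w)$ if $\overline{v}_{a,\gamma}|_{K(X)}=w$. It is a minimal pair of definition if moreover, for all $b\in\overline{K}$, $\overline{v}(a-b)\geq\gamma$ implies $[K(a):K]\leq[K(b):K]$. An algebraic extension $(K(a)|K,\overline{v})$ is unibranched if the valuation $v$ of $K$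 has a unique extension to $K(a)$. *)

theory Defs
  imports
    "HOL-Algebra.Free_Abelian_Groups"
    "HOL-Algebra.Generated_Groups"
    "HOL-Algebra.QuotRing"
    "HOL-Computational_Algebra.Polynomial"
    "HOL-Computational_Algebra.Fraction_Field"
    "HOL-Computational_Algebra.Factorial_Ring"
    "HOL-Library.Extended_Nat"
    "HOL-Library.Poly_Mapping"
    "HOL.Hull"
begin

section \<open>Field extensions\<close>

definition is_subfield :: "'f::field set \<Rightarrow> bool" where
  "is_subfield L \<longleftrightarrow> 0 \<in> L \<and> 1 \<in> L \<and>
     (\<forall>x\<in>L. \<forall>y\<in>L. x - y \<in> L \<and> x * y \<in> L) \<and> (\<forall>x\<in>L. inverse x \<in> L)"

definition field_embedding :: "('k::field \<Rightarrow> 'c::field) \<Rightarrow> bool" where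
  "field_embedding \<iota> \<longleftrightarrow> \<iota> 1 = 1 \<and>
     (\<forall>x y. \<iota> (x + y) = \<iota> x + \<iota> y) \<and> (\<forall>x y. \<iota> (x * y) = \<iota> x * \<iota> y)"

definition is_algebraic_closure :: "('k::field \<Rightarrow> 'c::alg_closed_field) \<Rightarrow> bool" where
  "is_algebraic_closure \<iota> \<longleftrightarrow> field_embedding \<iota> \<and>
     (\<forall>x. \<exists>p. p \<noteq> 0 \<and> poly (map_poly \<iota> p) x = 0)"

definition adjoin :: "('k::field \<Rightarrow> 'c::field) \<Rightarrow> 'c \<Rightarrow> 'c set" where
  "adjoin \<iota> a = is_subfield hull (insert a (range \<iota>))"

definition extension_degree :: "('k::field \<Rightarrow> 'c::field) \<Rightarrow> 'c set \<Rightarrow> nat" where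
  "extension_degree \<iota> L = vector_space.dim (\<lambda>c x. \<iota> c * x) L"

text \<open>Conjugate elements are roots of the same minimal polynomial over \<open>K\<close>.\<close>
definition conjugate_over :: "('k::field \<Rightarrow> 'c::field) \<Rightarrow> 'c \<Rightarrow> 'c \<Rightarrow> bool" where
  "conjugate_over \<iota> a a' \<longleftrightarrow>
     (\<exists>f :: 'k poly. irreducible f \<and> lead_coeff f = 1 \<and>
        poly (map_poly \<iota> f) a = 0 \<and> poly (map_poly \<iota> f) a' = 0)"

section \<open>Valuations\<close>

text \<open>A Krull valuation on the subfield \<open>L\<close> is given by its values on the nonzero elements of \<open>L\<close>;
  \<open>v 0 = \<infinity>\<close> is implicit. The value of the function at \<open>0\<close> (and outside \<open>L\<close>) is irrelevant and
  never referred to. The codomain need not be the value group, only an ordered abelian group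
  containing it.\<close>
definition valuation_on :: "'f::field set \<Rightarrow> ('f \<Rightarrow> 'g::linordered_ab_group_add) \<Rightarrow> bool" where
  "valuation_on L v \<longleftrightarrow>
     (\<forall>x\<in>L - {0}. \<forall>y\<in>L - {0}. v (x * y) = v x + v y) \<and>
     (\<forall>x\<in>L - {0}. \<forall>y\<in>L - {0}. x + y \<noteq> 0 \<longrightarrow> min (v x) (v y) \<le> v (x + y))"

abbreviation valuation :: "('f::field \<Rightarrow> 'g::linordered_ab_group_add) \<Rightarrow> bool" where
  "valuation \<equiv> valuation_on UNIV"

definition extends_val :: "('k::field \<Rightarrow> 'f::field) \<Rightarrow> ('k \<Rightarrow> 'g::linordered_ab_group_add)
    \<Rightarrow> 'f set \<Rightarrow> ('f \<Rightarrow> 'g) \<Rightarrow> bool" where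
  "extends_val \<iota> v L u \<longleftrightarrow> valuation_on L u \<and> (\<forall>x. x \<noteq> 0 \<longrightarrow> u (\<iota> x) = v x)"

text \<open>Uniqueness of the extension of \<open>v\<close> to an algebraic extension \<open>L\<close>. It is enough to compare
  extensions with values in \<open>'g\<close> as soon as \<open>'g\<close> contains the divisible hull of the value group
  \<open>vK\<close>, in particular as soon as some extension of \<open>v\<close> to the algebraic closure has values in
  \<open>'g\<close>: since \<open>L\<close> is algebraic over \<open>K\<close>, the value group of every extension embeds uniquely over
  \<open>vK\<close> into that divisible hull. Moreover, equivalent extensions with values in \<open>'g\<close> that agree
  on \<open>K\<close> are equal.\<close>
definition unique_extension :: "('k::field \<Rightarrow> 'c::field) \<Rightarrow> ('k \<Rightarrow> 'g::linordered_ab_group_add)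
    \<Rightarrow> 'c set \<Rightarrow> bool" where
  "unique_extension \<iota> v L \<longleftrightarrow>
     (\<exists>u. extends_val \<iota> v L u \<and>
        (\<forall>u'. extends_val \<iota> v L u' \<longrightarrow> (\<forall>x\<in>L - {0}. u' x = u x)))"

definition unibranched :: "('k::field \<Rightarrow> 'c::field) \<Rightarrow> ('k \<Rightarrow> 'g::linordered_ab_group_add)
    \<Rightarrow> 'c \<Rightarrow> bool" where
  "unibranched \<iota> v a \<longleftrightarrow> unique_extension \<iota> v (adjoin \<iota> a)"

text \<open>Here \<open>\<iota>\<close> is meant to be the embedding into an algebraic closure, so that \<open>L\<close> ranges over all
  algebraic extensions of \<open>K\<close> up to isomorphism.\<close>
definition henselian :: "('k::field \<Rightarrow> 'c::field) \<Rightarrow> ('k \<Rightarrow> 'g::linordered_ab_group_add)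
    \<Rightarrow> bool" where
  "henselian \<iota> v \<longleftrightarrow> (\<forall>L. is_subfield L \<and> range \<iota> \<subseteq> L \<longrightarrow> unique_extension \<iota> v L)"

section \<open>Dimension of the rational tensor product of an abelian group\<close>

text \<open>HOL-Algebra writes abelian groups multiplicatively. The tensor product
  \<open>\<rat> \<otimes>\<^sub>\<int> A\<close> is the free abelian group on \<open>\<rat> \<times> A\<close> modulo the biadditivity relations, with scalars
  acting by \<open>q \<bullet> (r \<otimes> a) = q r \<otimes> a\<close>.\<close>

definition tensor_free :: "'x monoid \<Rightarrow> ((rat \<times> 'x) \<Rightarrow>\<^sub>0 int) monoid" where
  "tensor_free A = free_Abelian_group (UNIV \<times> carrier A)"

definition tensor_relations :: "'x monoid \<Rightarrow> ((rat \<times> 'x) \<Rightarrow>\<^sub>0 int) set" where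
  "tensor_relations A = generate (tensor_free A)
     ({frag_of (q + r, a) - frag_of (q, a) - frag_of (r, a) | q r a. a \<in> carrier A} \<union>
      {frag_of (q, a \<otimes>\<^bsub>A\<^esub> b) - frag_of (q, a) - frag_of (q, b) | q a b.
         a \<in> carrier A \<and> b \<in> carrier A})"

definition rat_tensor :: "'x monoid \<Rightarrow> ((rat \<times> 'x) \<Rightarrow>\<^sub>0 int) set monoid" where
  "rat_tensor A = tensor_free A Mod tensor_relations A"

definition rat_tensor_smult ::
    "'x monoid \<Rightarrow> rat \<Rightarrow> ((rat \<times> 'x) \<Rightarrow>\<^sub>0 int) set \<Rightarrow> ((rat \<times> 'x) \<Rightarrow>\<^sub>0 int) set" where
  "rat_tensor_smult A q C =
     (\<Union>z\<in>C. tensor_relations A #>\<^bsub>tensor_free A\<^esub> frag_extend (\<lambda>(r, a). frag_of (q * r, a)) z)"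

definition rat_tensor_independent :: "'x monoid \<Rightarrow> ((rat \<times> 'x) \<Rightarrow>\<^sub>0 int) set set \<Rightarrow> bool" where
  "rat_tensor_independent A S \<longleftrightarrow> finite S \<and> S \<subseteq> carrier (rat_tensor A) \<and>
     (\<forall>c. finprod (rat_tensor A) (\<lambda>x. rat_tensor_smult A (c x) x) S = \<one>\<^bsub>rat_tensor A\<^esub>
        \<longrightarrow> (\<forall>x\<in>S. c x = 0))"

definition rat_tensor_dim :: "'x monoid \<Rightarrow> enat" where
  "rat_tensor_dim A = (SUP S\<in>{S. rat_tensor_independent A S}. enat (card S))"

section \<open>Transcendence degree\<close>

text \<open>Algebraic independence over the subfield \<open>k\<close> of \<open>E\<close> of a finite set \<open>S\<close>. A polynomial in the
  variables \<open>S\<close> is given by a finite set \<open>P\<close> of exponent functions and coefficients \<open>c\<close>.\<close>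
definition algebraically_independent :: "'x ring \<Rightarrow> 'x set \<Rightarrow> 'x set \<Rightarrow> bool" where
  "algebraically_independent E k S \<longleftrightarrow> finite S \<and> S \<subseteq> carrier E \<and>
     (\<forall>(P :: ('x \<Rightarrow> nat) set) c.
        finite P \<and> (\<forall>e\<in>P. \<forall>x. x \<notin> S \<longrightarrow> e x = 0) \<and> (\<forall>e\<in>P. c e \<in> k) \<and>
        finsum E (\<lambda>e. c e \<otimes>\<^bsub>E\<^esub> finprod E (\<lambda>x. x [^]\<^bsub>E\<^esub> e x) S) P = \<zero>\<^bsub>E\<^esub>
        \<longrightarrow> (\<forall>e\<in>P. c e = \<zero>\<^bsub>E\<^esub>))"

definition transcendence_degree :: "'x ring \<Rightarrow> 'x set \<Rightarrow> enat" where
  "transcendence_degree E k = (SUP S\<in>{S. algebraically_independent E k S}. enat (card S))"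

section \<open>Valuation transcendental extensions\<close>

definition value_group :: "('f::field \<Rightarrow> 'g::linordered_ab_group_add) \<Rightarrow> 'g set" where
  "value_group v = v ` (- {0})"

definition additive_group :: "'g::ab_group_add set \<Rightarrow> 'g monoid" where
  "additive_group G = \<lparr>carrier = G, monoid.mult = (+), one = 0\<rparr>"

definition valuation_ring_set :: "('f::field \<Rightarrow> 'g::linordered_ab_group_add) \<Rightarrow> 'f set" where
  "valuation_ring_set v = {x. x = 0 \<or> 0 \<le> v x}"

definition valuation_ring :: "('f::field \<Rightarrow> 'g::linordered_ab_group_add) \<Rightarrow> 'f ring" where
  "valuation_ring v =
     \<lparr>carrier = valuation_ring_set v, monoid.mult = (*), one = 1, ring.zero = 0, add = (+)\<rparr>"

definition valuation_ideal :: "('f::field \<Rightarrow> 'g::linordered_ab_group_add) \<Rightarrow> 'f set" where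
  "valuation_ideal v = {x. x = 0 \<or> 0 < v x}"

definition residue_field :: "('f::field \<Rightarrow> 'g::linordered_ab_group_add) \<Rightarrow> 'f set ring" where
  "residue_field v = valuation_ring v Quot valuation_ideal v"

text \<open>The image of the residue field \<open>Kv\<close> in the residue field of an extension \<open>w\<close> of \<open>v\<close>.\<close>
definition base_residue_field :: "('k::field \<Rightarrow> 'f::field) \<Rightarrow> ('k \<Rightarrow> 'g::linordered_ab_group_add)
    \<Rightarrow> ('f \<Rightarrow> 'g) \<Rightarrow> 'f set set" where
  "base_residue_field \<iota> v w =
     (\<lambda>c. valuation_ideal w +>\<^bsub>valuation_ring w\<^esub> \<iota> c) ` valuation_ring_set v"

definition ratfun_const :: "'k::field \<Rightarrow> 'k poly fract" where
  "ratfun_const c = Fract [:c:] 1"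

definition valuation_transcendental :: "('k::field \<Rightarrow> 'g::linordered_ab_group_add)
    \<Rightarrow> ('k poly fract \<Rightarrow> 'g) \<Rightarrow> bool" where
  "valuation_transcendental v w \<longleftrightarrow> extends_val ratfun_const v UNIV w \<and>
     rat_tensor_dim (additive_group (value_group w) Mod value_group v) +
     transcendence_degree (residue_field w) (base_residue_field ratfun_const v w) = 1"

section \<open>Pairs of definition\<close>

text \<open>\<open>p \<circ>\<^sub>p [:a, 1:]\<close> is \<open>p (X + a)\<close>, whose coefficients are the \<open>c\<^sub>i\<close> in \<open>p = (\<Sum>i. c\<^sub>i (X - a)\<^sup>i)\<close>.
  Terms with \<open>c\<^sub>i = 0\<close> have value \<open>\<infinity>\<close> and do not contribute to the minimum.\<close>
definition min_term_value :: "('c::field \<Rightarrow> 'g::linordered_ab_group_add) \<Rightarrow> 'c \<Rightarrow> 'g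
    \<Rightarrow> 'c poly \<Rightarrow> 'g" where
  "min_term_value vb a \<gamma> p =
     (let c = coeff (p \<circ>\<^sub>p [:a, 1:])
      in Min ((\<lambda>i. vb (c i) + (\<Sum>j<i. \<gamma>)) ` {i. c i \<noteq> 0}))"

text \<open>A valuation on \<open>K(X)\<close> is determined, up to its irrelevant value at \<open>0\<close>, by its values on nonzero
  polynomials; existence is the lemma \<open>pair_valuation\<close> below.\<close>
definition pair_valuation :: "('c::field \<Rightarrow> 'g::linordered_ab_group_add) \<Rightarrow> 'c \<Rightarrow> 'g
    \<Rightarrow> 'c poly fract \<Rightarrow> 'g" where
  "pair_valuation vb a \<gamma> = (SOME u. valuation u \<and>
     (\<forall>p. p \<noteq> 0 \<longrightarrow> u (Fract p 1) = min_term_value vb a \<gamma> p))"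

lemma valuation_min_ge:
  assumes "valuation v" "x = 0 \<or> m \<le> v x" "y = 0 \<or> m \<le> v y"
  shows "x + y = 0 \<or> m \<le> v (x + y)"
proof (cases "x = 0 \<or> y = 0 \<or> x + y = 0")
  case False
  then have "min (v x) (v y) \<le> v (x + y)"
    using assms(1) by (simp add: valuation_on_def)
  moreover have "m \<le> min (v x) (v y)"
    using False assms(2,3) by simp
  ultimately show ?thesis using order_trans order_less_le_trans by blast
qed (use assms in auto)

lemma valuation_sum_ge:
  assumes "valuation v" "finite A" "\<And>i. i \<in> A \<Longrightarrow> f i = 0 \<or> m \<le> v (f i)"
  shows "sum f A = 0 \<or> m \<le> v (sum f A)"
  using assms(2,3)
proof (induction A rule: finite_induct)
  case (insert x F)
  then show ?case
    using valuation_min_ge[OF assms(1), of "f x" m "sum f F"] by simp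
qed simp

lemma valuation_min_gt:
  assumes "valuation v" "x = 0 \<or> m < v x" "y = 0 \<or> m < v y"
  shows "x + y = 0 \<or> m < v (x + y)"
proof (cases "x = 0 \<or> y = 0 \<or> x + y = 0")
  case False
  then have "min (v x) (v y) \<le> v (x + y)"
    using assms(1) by (simp add: valuation_on_def)
  moreover have "m < min (v x) (v y)"
    using False assms(2,3) by simp
  ultimately show ?thesis using order_trans order_less_le_trans by blast
qed (use assms in auto)

lemma valuation_sum_gt:
  assumes "valuation v" "finite A" "\<And>i. i \<in> A \<Longrightarrow> f i = 0 \<or> m < v (f i)"
  shows "sum f A = 0 \<or> m < v (sum f A)"
  using assms(2,3)
proof (induction A rule: finite_induct)
  case (insert x F)
  then show ?case
    using valuation_min_gt[OF assms(1), of "f x" m "sum f F"] by simp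
qed simp

lemma valuation_mult:
  assumes "valuation v" "x \<noteq> 0" "y \<noteq> 0"
  shows "v (x * y) = v x + v y"
  using assms unfolding valuation_on_def by auto

lemma valuation_uminus:
  fixes v :: "'f::field \<Rightarrow> 'g::linordered_ab_group_add"
  assumes "valuation v" "x \<noteq> 0"
  shows "v (- x) = v x"
proof -
  have z: "g = 0" if "g + g = 0" for g :: 'g
    using that by (metis add_less_same_cancel1 add_neg_neg add_pos_pos less_irrefl neq_iff)
  have "v 1 + v 1 = v (1 * 1)" using valuation_mult[OF assms(1), of 1 1] by simp
  then have "v 1 = 0" by simp
  moreover have "v (-1) + v (-1) = v ((-1) * (-1))"
    using valuation_mult[OF assms(1), of "-1" "-1"] by simp
  ultimately have "v (-1) = 0" by (simp add: z)
  then show ?thesis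
    using valuation_mult[OF assms(1), of "-1" x] assms(2) by simp
qed

lemma valuation_add_gt:
  assumes v: "valuation v" and x: "x \<noteq> 0" and y: "y = 0 \<or> v x < v y"
  shows "x + y \<noteq> 0 \<and> v (x + y) = v x"
proof (cases "y = 0")
  case True
  then show ?thesis using x by simp
next
  case False
  then have lt: "v x < v y" using y by simp
  have my: "v (- y) = v y" using valuation_uminus[OF v False] .
  have nz: "x + y \<noteq> 0"
    using lt my by (metis add_eq_0_iff2 less_irrefl)
  have "v x \<le> v (x + y)"
    using valuation_min_ge[OF v, of x "v x" y] less_imp_le[OF lt] nz by auto
  moreover have "\<not> v x < v (x + y)"
    using valuation_min_gt[OF v, of "x + y" "v x" "- y"] lt my nz False x by auto
  ultimately show ?thesis using nz by auto
qed

lemma min_term_value: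
  fixes vb :: "'c::field \<Rightarrow> 'g::linordered_ab_group_add" and a :: "'c"
  assumes "p \<noteq> 0"
  defines "c \<equiv> coeff (p \<circ>\<^sub>p [:a, 1:])"
  shows min_term_value_le: "c i \<noteq> 0 \<Longrightarrow> min_term_value vb a \<gamma> p \<le> vb (c i) + (\<Sum>j<i. \<gamma>)"
    and min_term_value_attained:
      "\<exists>i. c i \<noteq> 0 \<and> vb (c i) + (\<Sum>j<i. \<gamma>) = min_term_value vb a \<gamma> p \<and>
        (\<forall>j<i. c j \<noteq> 0 \<longrightarrow> min_term_value vb a \<gamma> p < vb (c j) + (\<Sum>l<j. \<gamma>))"
proof -
  let ?t = "\<lambda>i. vb (c i) + (\<Sum>j<i. \<gamma>)"
  let ?m = "min_term_value vb a \<gamma> p"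
  have m: "?m = Min (?t ` {i. c i \<noteq> 0})"
    by (simp add: min_term_value_def c_def Let_def)
  have "p \<circ>\<^sub>p [:a, 1:] \<noteq> 0"
    using assms(1) by (simp add: pcompose_eq_0_iff)
  then have ne: "{i. c i \<noteq> 0} \<noteq> {}"
    using leading_coeff_neq_0[of "p \<circ>\<^sub>p [:a, 1:]"] unfolding c_def by blast
  have fin: "finite {i. c i \<noteq> 0}"
    unfolding c_def by (rule finite_subset[of _ "{..degree (p \<circ>\<^sub>p [:a, 1:])}"]) (auto intro: le_degree)
  show le: "?m \<le> ?t i" if "c i \<noteq> 0" for i
    unfolding m using fin that by (intro Min_le) auto
  have "?m \<in> ?t ` {i. c i \<noteq> 0}"
    unfolding m using fin ne by (intro Min_in) auto
  then have ex: "\<exists>i. c i \<noteq> 0 \<and> ?t i = ?m" by auto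
  define i where "i = (LEAST i. c i \<noteq> 0 \<and> ?t i = ?m)"
  have "c i \<noteq> 0 \<and> ?t i = ?m" unfolding i_def by (rule LeastI_ex[OF ex])
  moreover have "?m < ?t j" if "j < i" "c j \<noteq> 0" for j
    using not_less_Least[of j "\<lambda>i. c i \<noteq> 0 \<and> ?t i = ?m"] that le[of j] by (auto simp: i_def)
  ultimately show "\<exists>i. c i \<noteq> 0 \<and> ?t i = ?m \<and> (\<forall>j<i. c j \<noteq> 0 \<longrightarrow> ?m < ?t j)" by blast
qed

lemma min_term_value_add:
  assumes v: "valuation vb" and p: "p \<noteq> 0" and q: "q \<noteq> 0" and pq: "p + q \<noteq> 0"
  shows "min (min_term_value vb a \<gamma> p) (min_term_value vb a \<gamma> q)
    \<le> min_term_value vb a \<gamma> (p + q)" (is "?m \<le> _")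
proof -
  let ?c = "\<lambda>p. coeff (p \<circ>\<^sub>p [:a, 1:])"
  obtain i where i: "?c (p + q) i \<noteq> 0"
    "vb (?c (p + q) i) + (\<Sum>j<i. \<gamma>) = min_term_value vb a \<gamma> (p + q)"
    using min_term_value_attained[OF pq] by metis
  have "?c p i = 0 \<or> ?m - (\<Sum>j<i. \<gamma>) \<le> vb (?c p i)"
    using min_term_value_le[OF p, of a i vb \<gamma>] by (auto simp: algebra_simps min_le_iff_disj)
  moreover have "?c q i = 0 \<or> ?m - (\<Sum>j<i. \<gamma>) \<le> vb (?c q i)"
    using min_term_value_le[OF q, of a i vb \<gamma>] by (auto simp: algebra_simps min_le_iff_disj)
  ultimately have "?m - (\<Sum>j<i. \<gamma>) \<le> vb (?c (p + q) i)"
    using valuation_min_ge[OF v] i(1) by (fastforce simp: pcompose_add)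
  then show ?thesis
    using i(2) by (simp add: diff_le_eq)
qed

lemma sum_const_lessThan_add:
  fixes \<gamma> :: "'g::linordered_ab_group_add"
  shows "(\<Sum>l<i + j. \<gamma>) = (\<Sum>l<i. \<gamma>) + (\<Sum>l<(j::nat). \<gamma>)"
  by (induction j) (simp_all add: add.assoc)

lemma min_term_value_mult:
  assumes v: "valuation vb" and p: "p \<noteq> 0" and q: "q \<noteq> 0"
  shows "min_term_value vb a \<gamma> (p * q) = min_term_value vb a \<gamma> p + min_term_value vb a \<gamma> q"
proof -
  let ?c = "\<lambda>p. coeff (p \<circ>\<^sub>p [:a, 1:])"
  let ?n = "\<lambda>i::nat. \<Sum>l<i. \<gamma>"
  let ?M = "min_term_value vb a \<gamma>"
  have pq: "p * q \<noteq> 0" using p q by simp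
  have cm: "?c (p * q) n = (\<Sum>i\<le>n. ?c p i * ?c q (n - i))" for n
    by (simp add: pcompose_mult coeff_mult)
  have val: "vb (?c p i * ?c q j) = (vb (?c p i) + ?n i) + (vb (?c q j) + ?n j) - ?n (i + j)"
    if "?c p i \<noteq> 0" "?c q j \<noteq> 0" for i j
    using valuation_mult[OF v that] by (simp add: sum_const_lessThan_add)
  have ge: "?M p + ?M q \<le> ?M (p * q)"
  proof -
    obtain k where k: "?c (p * q) k \<noteq> 0" "vb (?c (p * q) k) + ?n k = ?M (p * q)"
      using min_term_value_attained[OF pq] by metis
    have "?c p i * ?c q (k - i) = 0 \<or> ?M p + ?M q - ?n k \<le> vb (?c p i * ?c q (k - i))"
      if "i \<in> {..k}" for i
    proof (cases "?c p i = 0 \<or> ?c q (k - i) = 0")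
      case False
      then have "?M p + ?M q \<le> (vb (?c p i) + ?n i) + (vb (?c q (k - i)) + ?n (k - i))"
        using min_term_value_le[OF p, of a i vb \<gamma>] min_term_value_le[OF q, of a "k - i" vb \<gamma>]
        by (intro add_mono) auto
      then show ?thesis
        using val[of i "k - i"] False that by (auto intro: diff_right_mono)
    qed auto
    then have "sum (\<lambda>i. ?c p i * ?c q (k - i)) {..k} = 0 \<or>
        ?M p + ?M q - ?n k \<le> vb (sum (\<lambda>i. ?c p i * ?c q (k - i)) {..k})"
      by (rule valuation_sum_ge[OF v finite_atMost])
    then have "?M p + ?M q - ?n k \<le> vb (?c (p * q) k)"
      using k(1) by (simp add: cm)
    then show ?thesis using k(2) by (simp add: diff_le_eq)
  qed
  obtain i where i: "?c p i \<noteq> 0" "vb (?c p i) + ?n i = ?M p"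
    "\<And>l. l < i \<Longrightarrow> ?c p l \<noteq> 0 \<Longrightarrow> ?M p < vb (?c p l) + ?n l"
    using min_term_value_attained[OF p] by metis
  obtain j where j: "?c q j \<noteq> 0" "vb (?c q j) + ?n j = ?M q"
    "\<And>l. l < j \<Longrightarrow> ?c q l \<noteq> 0 \<Longrightarrow> ?M q < vb (?c q l) + ?n l"
    using min_term_value_attained[OF q] by metis
  let ?r = "\<Sum>l\<in>{..i + j} - {i}. ?c p l * ?c q (i + j - l)"
  have split: "?c (p * q) (i + j) = ?c p i * ?c q j + ?r"
    unfolding cm by (subst sum.remove[of _ i]) auto
  have v0: "vb (?c p i * ?c q j) = ?M p + ?M q - ?n (i + j)"
    using val[OF i(1) j(1)] i(2) j(2) by simp
  have "?c p l * ?c q (i + j - l) = 0 \<or>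
      ?M p + ?M q - ?n (i + j) < vb (?c p l * ?c q (i + j - l))"
    if l: "l \<in> {..i + j} - {i}" for l
  proof (cases "?c p l = 0 \<or> ?c q (i + j - l) = 0")
    case False
    have "?M p + ?M q < (vb (?c p l) + ?n l) + (vb (?c q (i + j - l)) + ?n (i + j - l))"
    proof (cases "l < i")
      case True
      then show ?thesis
        using False i(3)[of l] min_term_value_le[OF q, of a "i + j - l" vb \<gamma>]
        by (intro add_less_le_mono) auto
    next
      case nl: False
      then have "i + j - l < j" using l by auto
      then show ?thesis
        using False j(3)[of "i + j - l"] min_term_value_le[OF p, of a l vb \<gamma>]
        by (intro add_le_less_mono) auto
    qed
    then show ?thesis
      using val[of l "i + j - l"] False l by (auto intro: diff_strict_right_mono)
  qed auto
  then have "?r = 0 \<or> ?M p + ?M q - ?n (i + j) < vb ?r"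
    by (intro valuation_sum_gt[OF v]) auto
  then have "?r = 0 \<or> vb (?c p i * ?c q j) < vb ?r" by (simp only: v0)
  then have "?c (p * q) (i + j) \<noteq> 0 \<and> vb (?c (p * q) (i + j)) = vb (?c p i * ?c q j)"
    unfolding split using i(1) j(1) by (intro valuation_add_gt[OF v]) auto
  then have "?M (p * q) \<le> ?M p + ?M q - ?n (i + j) + ?n (i + j)"
    using min_term_value_le[OF pq, of a "i + j" vb \<gamma>] v0 by metis
  then show ?thesis using ge by simp
qed

text \<open>Gauss's lemma: the valuation chosen in \<open>pair_valuation\<close> exists.\<close>
lemma pair_valuation:
  fixes vb :: "'c::field \<Rightarrow> 'g::linordered_ab_group_add"
  assumes v: "valuation vb"
  shows "valuation (pair_valuation vb a \<gamma>)"
    and "p \<noteq> 0 \<Longrightarrow> pair_valuation vb a \<gamma> (Fract p 1) = min_term_value vb a \<gamma> p"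
proof -
  let ?M = "min_term_value vb a \<gamma>"
  define u where "u r = (SOME g. \<exists>p q. p \<noteq> 0 \<and> q \<noteq> 0 \<and> r = Fract p q \<and> g = ?M p - ?M q)"
    for r
  have u: "u (Fract p q) = ?M p - ?M q" if pq: "p \<noteq> 0" "q \<noteq> 0" for p q
    unfolding u_def
  proof (rule some_equality)
    fix g assume "\<exists>p' q'. p' \<noteq> 0 \<and> q' \<noteq> 0 \<and> Fract p q = Fract p' q' \<and> g = ?M p' - ?M q'"
    then obtain p' q' where *: "p' \<noteq> 0" "q' \<noteq> 0" "Fract p q = Fract p' q'" "g = ?M p' - ?M q'"
      by blast
    then have "?M (p * q') = ?M (p' * q)" using pq by (simp add: eq_fract)
    then have "?M p + ?M q' = ?M p' + ?M q"
      using pq * by (simp add: min_term_value_mult[OF v])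
    then have "?M p' + ?M q - ?M q' = ?M p" by (metis add_diff_cancel_right')
    then show "g = ?M p - ?M q" by (simp only: *(4) eq_diff_eq diff_add_eq)
  qed (use pq in blast)
  have mult: "u (x * y) = u x + u y" if xy: "x \<noteq> 0" "y \<noteq> 0" for x y
  proof -
    obtain p q where x: "x = Fract p q" "q \<noteq> 0" "p \<noteq> 0"
      using xy by (cases x rule: Fract_cases_nonzero) auto
    obtain p' q' where y: "y = Fract p' q'" "q' \<noteq> 0" "p' \<noteq> 0"
      using xy by (cases y rule: Fract_cases_nonzero) auto
    show ?thesis using x y by (simp add: u min_term_value_mult[OF v])
  qed
  have add: "min (u x) (u y) \<le> u (x + y)" if xy: "x \<noteq> 0" "y \<noteq> 0" "x + y \<noteq> 0" for x y
  proof -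
    obtain p q where x: "x = Fract p q" "q \<noteq> 0" "p \<noteq> 0"
      using xy by (cases x rule: Fract_cases_nonzero) auto
    obtain p' q' where y: "y = Fract p' q'" "q' \<noteq> 0" "p' \<noteq> 0"
      using xy by (cases y rule: Fract_cases_nonzero) auto
    have s: "x + y = Fract (p * q' + p' * q) (q * q')" using x y by simp
    then have nz: "p * q' + p' * q \<noteq> 0" using xy(3) by (auto simp: fract_collapse)
    have "min (?M (p * q')) (?M (p' * q)) \<le> ?M (p * q' + p' * q)"
      using x y nz by (intro min_term_value_add[OF v]) auto
    then have "min (?M (p * q')) (?M (p' * q)) - ?M (q * q') \<le> u (x + y)"
      unfolding s using x y nz by (simp add: u diff_right_mono)
    moreover have "u x = ?M (p * q') - ?M (q * q')" "u y = ?M (p' * q) - ?M (q * q')"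
      using x y by (simp_all add: u min_term_value_mult[OF v])
    ultimately show ?thesis by (auto simp: min_def split: if_splits)
  qed
  have M1: "?M 1 = 0" using min_term_value_mult[OF v, of 1 1 a \<gamma>] by simp
  have "valuation u \<and> (\<forall>p. p \<noteq> 0 \<longrightarrow> u (Fract p 1) = ?M p)"
    using mult add by (auto simp: valuation_on_def u M1)
  from someI[of "\<lambda>u. valuation u \<and> (\<forall>p. p \<noteq> 0 \<longrightarrow> u (Fract p 1) = ?M p)", OF this]
  show "valuation (pair_valuation vb a \<gamma>)"
    "p \<noteq> 0 \<Longrightarrow> pair_valuation vb a \<gamma> (Fract p 1) = ?M p"
    unfolding pair_valuation_def by auto
qed

definition pair_of_definition :: "('k::field \<Rightarrow> 'c::field)
    \<Rightarrow> ('c \<Rightarrow> 'g::linordered_ab_group_add) \<Rightarrow> ('k poly fract \<Rightarrow> 'g) \<Rightarrow> 'c \<Rightarrow> 'g \<Rightarrow> bool" where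
  "pair_of_definition \<iota> vb w a \<gamma> \<longleftrightarrow>
     (\<forall>p q. p \<noteq> 0 \<and> q \<noteq> 0 \<longrightarrow>
        pair_valuation vb a \<gamma> (Fract (map_poly \<iota> p) (map_poly \<iota> q)) =
        w (Fract p q))"

text \<open>The premise is \<open>vb (a - b) \<ge> \<gamma>\<close>, with \<open>vb 0 = \<infinity>\<close>.\<close>
definition minimal_pair_of_definition :: "('k::field \<Rightarrow> 'c::field)
    \<Rightarrow> ('c \<Rightarrow> 'g::linordered_ab_group_add) \<Rightarrow> ('k poly fract \<Rightarrow> 'g) \<Rightarrow> 'c \<Rightarrow> 'g \<Rightarrow> bool" where
  "minimal_pair_of_definition \<iota> vb w a \<gamma> \<longleftrightarrow> pair_of_definition \<iota> vb w a \<gamma> \<and>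
     (\<forall>b. a = b \<or> \<gamma> \<le> vb (a - b) \<longrightarrow>
        extension_degree \<iota> (adjoin \<iota> a) \<le> extension_degree \<iota> (adjoin \<iota> b))"

end

theory Submission
  imports Defs
begin

text \<open>The coefficients of \<open>f (X + a)\<close>, for \<open>f\<close> over \<open>K\<close>, are polynomial expressions in \<open>a\<close> over \<open>K\<close>,
  and those of \<open>f (X + a')\<close> are their images under the \<open>K\<close>-isomorphism \<open>\<sigma> : K(a) \<rightarrow> K(a')\<close>.
  Since \<open>vb\<close> and \<open>vb \<circ> \<sigma>\<close> both extend \<open>v\<close> to \<open>K(a)\<close>, they agree there when \<open>K(a)\<close> is unibranched,
  so the two minima defining the values of \<open>f\<close> have the same terms.\<close>

section \<open>Evaluation at points of the extension field of polynomials over K\<close>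

context
  fixes \<iota> :: "'k::field \<Rightarrow> 'c::field"
  assumes emb: "field_embedding \<iota>"
begin

lemma embedding_0: "\<iota> 0 = 0"
  using emb unfolding field_embedding_def by (metis add.right_neutral add_left_cancel)

lemma embedding_eq_0_iff: "\<iota> x = 0 \<longleftrightarrow> x = 0"
  using emb embedding_0 unfolding field_embedding_def
  by (metis mult_zero_left right_inverse zero_neq_one)

lemma poly_map_embedding_pCons:
  "poly (map_poly \<iota> (pCons c p)) a = \<iota> c + a * poly (map_poly \<iota> p) a"
  by (simp add: map_poly_pCons embedding_0)

lemma poly_map_embedding_const: "poly (map_poly \<iota> [:c:]) a = \<iota> c"
  by (simp add: poly_map_embedding_pCons)

lemma map_poly_embedding_eq_0_iff: "map_poly \<iota> p = 0 \<longleftrightarrow> p = 0"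
  by (auto simp: poly_eq_iff coeff_map_poly embedding_0 embedding_eq_0_iff)

lemma poly_map_embedding_add:
  "poly (map_poly \<iota> (p + q)) a = poly (map_poly \<iota> p) a + poly (map_poly \<iota> q) a"
proof -
  have "map_poly \<iota> (p + q) = map_poly \<iota> p + map_poly \<iota> q"
    using emb by (auto simp: poly_eq_iff coeff_map_poly embedding_0 field_embedding_def)
  then show ?thesis by simp
qed

lemma poly_map_embedding_mult:
  "poly (map_poly \<iota> (p * q)) a = poly (map_poly \<iota> p) a * poly (map_poly \<iota> q) a"
proof -
  have smult: "poly (map_poly \<iota> (smult c r)) a = \<iota> c * poly (map_poly \<iota> r) a" for c r
    using emb by (induction r)
      (simp_all add: poly_map_embedding_pCons embedding_0 field_embedding_def algebra_simps)
  show ?thesis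
    by (induction p)
      (simp_all add: poly_map_embedding_pCons poly_map_embedding_add smult embedding_0 algebra_simps)
qed

lemma poly_map_embedding_diff:
  "poly (map_poly \<iota> (p - q)) a = poly (map_poly \<iota> p) a - poly (map_poly \<iota> q) a"
  using poly_map_embedding_add[of "p - q" q a] by (simp add: algebra_simps)

lemma poly_map_embedding_pcompose:
  "poly (map_poly \<iota> (p \<circ>\<^sub>p q)) a = poly (map_poly \<iota> p) (poly (map_poly \<iota> q) a)"
  by (induction p) (simp_all add: pcompose_pCons poly_map_embedding_pCons poly_map_embedding_const
      poly_map_embedding_add poly_map_embedding_mult)

text \<open>The point is the order of quantifiers: \<open>g\<close> depends on \<open>f\<close>
  alone, so the same polynomials over K give the coefficients at a and at a'. The i-th Hasse
  derivative of \<open>f\<close> can serve as \<open>g i\<close>.\<close>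

lemma coeff_shift_eq_poly:
  "\<exists>g. \<forall>a i. coeff (map_poly \<iota> f \<circ>\<^sub>p [:a, 1:]) i = poly (map_poly \<iota> (g i)) a"
proof (induction f)
  case 0
  show ?case by (rule exI[of _ "\<lambda>_. 0"]) simp
next
  case (pCons c f)
  then obtain g where g: "\<And>a i. coeff (map_poly \<iota> f \<circ>\<^sub>p [:a, 1:]) i = poly (map_poly \<iota> (g i)) a"
    by blast
  \<comment> \<open>Here c + X f becomes c + (X + a) f(X + a): the new i-th coefficient is a times
    the old one plus the old coefficient of index i - 1, with c in its place for i = 0.\<close>
  have "coeff (map_poly \<iota> (pCons c f) \<circ>\<^sub>p [:a, 1:]) i =
      poly (map_poly \<iota> (case i of 0 \<Rightarrow> pCons c (g 0) | Suc j \<Rightarrow> pCons 0 (g (Suc j)) + g j)) a" for a i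
    using g[of a 0] by (cases i) (simp_all add: map_poly_pCons embedding_0 pcompose_pCons g
        poly_map_embedding_add poly_map_embedding_pCons coeff_pCons)
  then show ?case by blast
qed

section \<open>Relations over K of algebraic and conjugate elements\<close>

text \<open>A nonzero polynomial m of least degree vanishing at a divides every polynomial vanishing
  at a, in particular f. As nonzero constants have no root, m is not a unit, so irreducibility makes
  f divide m and hence g.\<close>

lemma irreducible_dvd_if_common_root:
  assumes f: "irreducible f" "poly (map_poly \<iota> f) a = 0"
    and g: "poly (map_poly \<iota> g) a = 0"
  shows "f dvd g"
proof -
  define P where "P m \<longleftrightarrow> m \<noteq> 0 \<and> poly (map_poly \<iota> m) a = 0" for m
  have "P f" using f by (auto simp: P_def)
  then obtain m where m: "P m" and min: "\<And>q. P q \<Longrightarrow> degree m \<le> degree q"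
    using ex_has_least_nat[of P f degree] by blast
  have m_dvd: "m dvd q" if q: "poly (map_poly \<iota> q) a = 0" for q
  proof (rule ccontr)
    assume nd: "\<not> m dvd q"
    \<comment> \<open>The remainder still vanishes at a; being nonzero and of smaller degree, it
      contradicts the choice of m.\<close>
    have "poly (map_poly \<iota> (q mod m)) a = 0"
      using q m poly_map_embedding_diff[of q "q div m * m" a]
      by (simp add: minus_div_mult_eq_mod poly_map_embedding_mult P_def)
    then have "P (q mod m)" using nd by (auto simp: P_def mod_eq_0_iff_dvd)
    then have "degree m \<le> degree (q mod m)" by (rule min)
    moreover have "degree (q mod m) < degree m"
      using degree_mod_less[of m q] m nd by (auto simp: P_def mod_eq_0_iff_dvd)
    ultimately show False by simp
  qed
  have "\<not> is_unit m"
  proof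
    assume "is_unit m"
    then obtain c where "m = [:c:]" by (auto simp: is_unit_poly_iff)
    then show False using m by (auto simp: P_def poly_map_embedding_const embedding_eq_0_iff)
  qed
  then have "f dvd m"
    using irreducibleD'[OF f(1) m_dvd[OF f(2)]] by blast
  then show ?thesis using m_dvd[OF g] by (rule dvd_trans)
qed

text \<open>Both sides say that p - q is divisible by the common irreducible polynomial. Hence
  sending p(a) to p(a') is well defined and injective.\<close>

lemma conjugate_over_poly_eq:
  assumes "conjugate_over \<iota> a a'"
  shows "poly (map_poly \<iota> p) a = poly (map_poly \<iota> q) a \<longleftrightarrow>
    poly (map_poly \<iota> p) a' = poly (map_poly \<iota> q) a'"
proof -
  obtain f where f: "irreducible f" "poly (map_poly \<iota> f) a = 0" "poly (map_poly \<iota> f) a' = 0"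
    using assms unfolding conjugate_over_def by blast
  have dvd: "poly (map_poly \<iota> g) b = 0" if "f dvd g" "poly (map_poly \<iota> f) b = 0" for g b
    using that by (auto simp: dvd_def poly_map_embedding_mult)
  have "poly (map_poly \<iota> (p - q)) a = 0 \<longleftrightarrow> poly (map_poly \<iota> (p - q)) a' = 0"
    using f dvd irreducible_dvd_if_common_root by blast
  then show ?thesis by (simp add: poly_map_embedding_diff)
qed

text \<open>Read the relation as c + x p(x) = 0. If c is nonzero, then - p(x) / c is the inverse of
  x; if c = 0 and x is nonzero, x cancels and p is a shorter relation.\<close>

lemma algebraic_inverse_eq_poly:
  assumes "p \<noteq> 0" "poly (map_poly \<iota> p) x = 0"
  shows "\<exists>h. inverse x = poly (map_poly \<iota> h) x"
  using assms
proof (induction p)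
  case (pCons c p)
  show ?case
  proof (cases "x = 0")
    case True
    \<comment> \<open>By convention \<open>inverse 0 = 0\<close>, so the zero polynomial
      serves.\<close>
    then show ?thesis by (intro exI[of _ 0]) simp
  next
    case x: False
    show ?thesis
    proof (cases "c = 0")
      case True
      then show ?thesis
        using pCons x by (auto simp: poly_map_embedding_pCons embedding_0)
    next
      case False
      let ?h = "[:- inverse c:] * p"
      have "c * - inverse c + 1 = 0" using False by simp
      then have "\<iota> c * \<iota> (- inverse c) + 1 = 0"
        using emb embedding_0 unfolding field_embedding_def by metis
      then have "\<iota> c * \<iota> (- inverse c) = - 1" by (simp only: eq_neg_iff_add_eq_0)
      moreover have "x * poly (map_poly \<iota> p) x = - \<iota> c"
        using pCons.prems(2) by (simp add: poly_map_embedding_pCons eq_neg_iff_add_eq_0 add.commute)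
      ultimately have "x * poly (map_poly \<iota> ?h) x = 1"
        by (simp only: poly_map_embedding_mult poly_map_embedding_const mult.left_commute[of x])
          (simp add: mult.commute)
      then show ?thesis by (metis inverse_unique)
    qed
  qed
qed simp

end

section \<open>The simple extension K(a)\<close>

lemma subfield_adjoin: "is_subfield (adjoin \<iota> a)"
  \<comment> \<open>The hull is itself a subfield because arbitrary intersections of subfields are
    subfields.\<close>
  unfolding adjoin_def by (rule hull_in) (unfold is_subfield_def, blast)

lemma range_subset_adjoin: "range \<iota> \<subseteq> adjoin \<iota> a"
  unfolding adjoin_def by (rule order_trans[OF _ hull_subset]) auto

lemma subfield_closed:
  assumes L: "is_subfield L" and x: "x \<in> L" and y: "y \<in> L"
  shows "x + y \<in> L" "x * y \<in> L"
proof -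
  have "x - (0 - y) \<in> L" using assms unfolding is_subfield_def by metis
  then show "x + y \<in> L" by simp
  show "x * y \<in> L" using assms unfolding is_subfield_def by metis
qed

lemma poly_map_in_adjoin:
  assumes "field_embedding \<iota>"
  shows "poly (map_poly \<iota> p) a \<in> adjoin \<iota> a"
proof (induction p)
  case 0
  show ?case using subfield_adjoin[of \<iota> a] by (simp add: is_subfield_def)
next
  case (pCons c p)
  have "a \<in> adjoin \<iota> a"
    unfolding adjoin_def by (rule subsetD[OF hull_subset]) simp
  then show ?case
    unfolding poly_map_embedding_pCons[OF assms]
    using pCons range_subset_adjoin[of \<iota> a] by (intro subfield_closed[OF subfield_adjoin]) auto
qed

text \<open>Every element is algebraic over K, so K[a] is closed under inverses and is already the
  field K(a). A map given on the elements p(a) is therefore given on all of K(a).\<close>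

lemma adjoin_eq_range_poly:
  assumes "is_algebraic_closure \<iota>"
  shows "adjoin \<iota> a = range (\<lambda>p. poly (map_poly \<iota> p) a)" (is "_ = ?R")
proof
  have emb: "field_embedding \<iota>"
    and alg: "\<And>x. \<exists>p. p \<noteq> 0 \<and> poly (map_poly \<iota> p) x = 0"
    using assms unfolding is_algebraic_closure_def by auto
  show "?R \<subseteq> adjoin \<iota> a" using poly_map_in_adjoin[OF emb] by auto
  have R_const: "\<iota> c \<in> ?R" for c
    using poly_map_embedding_const[OF emb, of c a] by (metis rangeI)
  have "inverse x \<in> ?R" if x: "x \<in> ?R" for x
  proof -
    obtain q where q: "x = poly (map_poly \<iota> q) a" using x by auto
    \<comment> \<open>The inverse of x = q(a) is a polynomial in x; composing with q turns it into a
      polynomial in a.\<close>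
    obtain h where "inverse x = poly (map_poly \<iota> h) x"
      using alg algebraic_inverse_eq_poly[OF emb] by metis
    then have "inverse x = poly (map_poly \<iota> (h \<circ>\<^sub>p q)) a"
      by (simp add: q poly_map_embedding_pcompose[OF emb])
    then show ?thesis by blast
  qed
  moreover have "x - y \<in> ?R \<and> x * y \<in> ?R" if "x \<in> ?R" "y \<in> ?R" for x y
    using that
    by (auto simp flip: poly_map_embedding_diff[OF emb] poly_map_embedding_mult[OF emb])
  moreover have "0 \<in> ?R" "1 \<in> ?R"
    using R_const[of 0] R_const[of 1] emb
    by (simp_all add: embedding_0[OF emb] field_embedding_def)
  ultimately have "is_subfield ?R"
    unfolding is_subfield_def by blast
  moreover have "a \<in> ?R"
    using emb by (intro range_eqI[of _ _ "[:0, 1:]"])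
      (simp add: poly_map_embedding_pCons[OF emb] embedding_0[OF emb] field_embedding_def)
  ultimately show "adjoin \<iota> a \<subseteq> ?R"
    unfolding adjoin_def using R_const by (intro hull_minimal) auto
qed

section \<open>Transport of the valuation to conjugates\<close>

text \<open>The value p(a) is assumed nonzero because uniqueness of the extension compares
  valuations on nonzero elements only.\<close>

lemma unibranched_conjugate_value_eq:
  assumes cl: "is_algebraic_closure \<iota>"
    and vb: "extends_val \<iota> v UNIV vb"
    and uni: "unibranched \<iota> v a"
    and conj: "conjugate_over \<iota> a a'"
    and nz: "poly (map_poly \<iota> p) a \<noteq> 0"
  shows "vb (poly (map_poly \<iota> p) a') = vb (poly (map_poly \<iota> p) a)"
proof -
  have emb: "field_embedding \<iota>" using cl unfolding is_algebraic_closure_def by simp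
  let ?e = "\<lambda>p. poly (map_poly \<iota> p)"
  note conj_eq = conjugate_over_poly_eq[OF emb conj]
  \<comment> \<open>Any representative p of x may be chosen, since conjugates satisfy the same
    relations over K.\<close>
  define \<sigma> where "\<sigma> x = ?e (SOME p. ?e p a = x) a'" for x
  have \<sigma>: "\<sigma> (?e p a) = ?e p a'" for p
    unfolding \<sigma>_def using conj_eq someI[of "\<lambda>q. ?e q a = ?e p a" p] by blast
  \<comment> \<open>Injectivity of \<sigma>: nonzero elements, where the valuation axioms apply,
    stay nonzero.\<close>
  have nz_iff: "?e p a' = 0 \<longleftrightarrow> ?e p a = 0" for p
    using conj_eq[of p 0] by simp
  have val: "valuation vb" and ext: "\<And>x. x \<noteq> 0 \<Longrightarrow> vb (\<iota> x) = v x"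
    using vb unfolding extends_val_def by auto
  have L: "adjoin \<iota> a = range (\<lambda>p. ?e p a)" by (rule adjoin_eq_range_poly[OF cl])
  have "valuation_on (adjoin \<iota> a) (vb \<circ> \<sigma>)"
    unfolding valuation_on_def
  proof (intro conjI ballI impI)
    fix x y assume "x \<in> adjoin \<iota> a - {0}" "y \<in> adjoin \<iota> a - {0}"
    then obtain p q where x: "x = ?e p a" "?e p a \<noteq> 0" and y: "y = ?e q a" "?e q a \<noteq> 0"
      unfolding L by auto
    have mult: "\<sigma> (x * y) = \<sigma> x * \<sigma> y"
      unfolding x y using \<sigma>[of "p * q"] by (simp add: \<sigma> poly_map_embedding_mult[OF emb])
    have add: "\<sigma> (x + y) = \<sigma> x + \<sigma> y"
      unfolding x y using \<sigma>[of "p + q"] by (simp add: \<sigma> poly_map_embedding_add[OF emb])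
    have nz: "\<sigma> x \<noteq> 0" "\<sigma> y \<noteq> 0" using x y by (simp_all add: \<sigma> nz_iff)
    show "(vb \<circ> \<sigma>) (x * y) = (vb \<circ> \<sigma>) x + (vb \<circ> \<sigma>) y"
      using valuation_mult[OF val nz] by (simp add: mult)
    assume "x + y \<noteq> 0"
    then have "\<sigma> (x + y) \<noteq> 0"
      unfolding x y using \<sigma>[of "p + q"] nz_iff[of "p + q"]
      by (simp add: poly_map_embedding_add[OF emb])
    then show "min ((vb \<circ> \<sigma>) x) ((vb \<circ> \<sigma>) y) \<le> (vb \<circ> \<sigma>) (x + y)"
      using val nz by (simp add: add valuation_on_def)
  qed
  moreover have "(vb \<circ> \<sigma>) (\<iota> c) = v c" if "c \<noteq> 0" for c
    using \<sigma>[of "[:c:]"] ext[OF that] by (simp add: poly_map_embedding_const[OF emb])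
  ultimately have "extends_val \<iota> v (adjoin \<iota> a) (vb \<circ> \<sigma>)"
    unfolding extends_val_def by blast
  moreover have "extends_val \<iota> v (adjoin \<iota> a) vb"
    using vb unfolding extends_val_def valuation_on_def by simp
  ultimately have "(vb \<circ> \<sigma>) x = vb x" if "x \<in> adjoin \<iota> a - {0}" for x
    using uni that unfolding unibranched_def unique_extension_def by metis
  then show ?thesis
    using nz \<sigma> poly_map_in_adjoin[OF emb, of p a] by fastforce
qed

lemma unibranched_conjugate_pair_of_definition:
  assumes cl: "is_algebraic_closure \<iota>"
    and vb: "extends_val \<iota> v UNIV vb"
    and uni: "unibranched \<iota> v a"
    and conj: "conjugate_over \<iota> a a'"
    and pair: "pair_of_definition \<iota> vb w a \<gamma>"
  shows "pair_of_definition \<iota> vb w a' \<gamma>"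
proof -
  have emb: "field_embedding \<iota>" using cl unfolding is_algebraic_closure_def by simp
  have val: "valuation vb" using vb unfolding extends_val_def by simp
  have M: "min_term_value vb a' \<gamma> (map_poly \<iota> f) = min_term_value vb a \<gamma> (map_poly \<iota> f)" for f
  proof -
    obtain g where g: "\<And>a i. coeff (map_poly \<iota> f \<circ>\<^sub>p [:a, 1:]) i = poly (map_poly \<iota> (g i)) a"
      using coeff_shift_eq_poly[OF emb] by metis
    \<comment> \<open>The same coefficients vanish at a and a', so both minima run over the same
      indices.\<close>
    have "poly (map_poly \<iota> (g i)) a' = 0 \<longleftrightarrow> poly (map_poly \<iota> (g i)) a = 0" for i
      using conjugate_over_poly_eq[OF emb conj, of "g i" 0] by simp
    then have "(\<lambda>i. vb (poly (map_poly \<iota> (g i)) a') + (\<Sum>j<i. \<gamma>)) `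
          {i. poly (map_poly \<iota> (g i)) a' \<noteq> 0} =
        (\<lambda>i. vb (poly (map_poly \<iota> (g i)) a) + (\<Sum>j<i. \<gamma>)) `
          {i. poly (map_poly \<iota> (g i)) a \<noteq> 0}"
      using unibranched_conjugate_value_eq[OF cl vb uni conj] by (intro image_cong) auto
    then show ?thesis unfolding min_term_value_def Let_def g by simp
  qed
  \<comment> \<open>The Gauss valuation is specified on polynomials; multiplicativity determines it
    on quotients.\<close>
  have quot: "pair_valuation vb b \<gamma> (Fract p q) =
      min_term_value vb b \<gamma> p - min_term_value vb b \<gamma> q" if "p \<noteq> 0" "q \<noteq> 0" for b p q
  proof -
    have "Fract p q * Fract q 1 = Fract p 1"
      using that by (simp add: eq_fract)
    moreover have "Fract p q \<noteq> 0" "Fract q 1 \<noteq> 0"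
      using that by (simp_all add: eq_fract Zero_fract_def)
    ultimately show ?thesis
      using valuation_mult[OF pair_valuation(1)[OF val], of "Fract p q" "Fract q 1" b \<gamma>] that
      by (simp add: pair_valuation(2)[OF val])
  qed
  show ?thesis
    using pair unfolding pair_of_definition_def
    by (simp add: quot M map_poly_embedding_eq_0_iff[OF emb])
qed

lemma henselian_imp_unibranched: "henselian \<iota> v \<Longrightarrow> unibranched \<iota> v a"
  unfolding henselian_def unibranched_def
  using subfield_adjoin range_subset_adjoin by blast

theorem corollary3p2:
  fixes \<iota> :: "'k::field \<Rightarrow> 'c::alg_closed_field"
    and v :: "'k \<Rightarrow> 'g::linordered_ab_group_add"
    and vb :: "'c \<Rightarrow> 'g"
    and w :: "'k poly fract \<Rightarrow> 'g"
  assumes "is_algebraic_closure \<iota>"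
    and "valuation v"
    and "extends_val \<iota> v UNIV vb"
    and "valuation_transcendental v w"
  shows "(\<forall>a \<gamma>. minimal_pair_of_definition \<iota> vb w a \<gamma> \<and> unibranched \<iota> v a \<longrightarrow>
             (\<forall>a'. conjugate_over \<iota> a a' \<longrightarrow> pair_of_definition \<iota> vb w a' \<gamma>))
       \<and> (henselian \<iota> v \<longrightarrow>
             (\<forall>a \<gamma>. minimal_pair_of_definition \<iota> vb w a \<gamma> \<longrightarrow>
                (\<forall>a'. conjugate_over \<iota> a a' \<longrightarrow> pair_of_definition \<iota> vb w a' \<gamma>)))"
  using unibranched_conjugate_pair_of_definition[OF assms(1,3)] henselian_imp_unibranched
  unfolding minimal_pair_of_definition_def by blast

end
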